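(* Let $(u_n)_{n\ge0}$ be a sequence of fuzzy numbers, let $\mu$ be a fuzzy number, and let $s>p>0$ be real numbers. If $(u_n)$ is $E_p$ summable to $\mu$, then $(u_n)$ is $E_s$ summable to $\mu$.
   Context: A fuzzy number is a function $u:\mathbb{R}\to[0,1]$ that is normal ($u(t_0)=1$ for some $t_0$), fuzzy convex ($u(\lambda s+(1-\lambda)t)\ge\min\{u(s),u(t)\}$ for $s,t\in\mathbb{R}$, $\lambda\in[0,1]$), upper semicontinuous, and has compact support $\overline{\{t:u(t)>0\}}$. The set of fuzzy numbers is $E^1$. For $u\in E^1$ the $\alpha$-level set is $[u]_\alpha=\{t:u(t)\ge\alpha\}$ for $0<\alpha\le1$ and $[u]_0=\overline{\{t:u(t)>0\}}$; it is a compact interval, written $[u]_\alpha=[u^-_\alpha,u^+_\alpha]$. Addition and scalar multiplication ($k\in\mathbb{R}$) are defined by $[u+v]_\alpha=[u^-_\alpha+v^-_\alpha,\,u^+_\alpha+v^+_\alpha]$ and $[ku]_\alpha=k[u]_\alpha$ for all $\alpha\in[0,1]$. The metric on $E^1$ is $D(u,v)=\sup_{\alpha\in[0,1]}\max\{|u^-_\alpha-v^-_\alpha|,|u^+_\alpha-v^+_\alpha|\}$; convergence in $E^1$ is with respect to $D$. For real $p>0$, the ($p$-th order) Euler means of a sequence $(u_n)_{n\ge0}$ of fuzzy numbers are $t^p_n=\frac{1}{(p+1)^n}\sum_{k=0}^n\binom{n}{k}p^{n-k}u_k$, and $(u_n)$ is $E_p$ summable to $\mu\in E^1$ if $\lim_{n\to\infty}t^p_n=\mu$.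 *)

theory Defs
  imports "HOL-Analysis.Analysis"
begin

definition upper_semicontinuous :: "(real \<Rightarrow> real) \<Rightarrow> bool" where
  "upper_semicontinuous u \<longleftrightarrow> (\<forall>t. \<forall>e>0. \<forall>\<^sub>F s in nhds t. u s < u t + e)"

definition is_fuzzy_number :: "(real \<Rightarrow> real) \<Rightarrow> bool" where
  "is_fuzzy_number u \<longleftrightarrow>
     (\<forall>t. u t \<in> {0..1}) \<and>
     (\<exists>t. u t = 1) \<and>
     (\<forall>s t. \<forall>l\<in>{0..1}. u (l * s + (1 - l) * t) \<ge> min (u s) (u t)) \<and>
     upper_semicontinuous u \<and>
     compact (closure {t. u t > 0})"

lemma is_fuzzy_number_singleton: "is_fuzzy_number (\<lambda>t. if t = c then 1 else 0)"
proof -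
  have "\<forall>\<^sub>F s in nhds t. (if s = c then 1 else 0) < (if t = c then 1 else 0) + e"
    if "e > 0" for t and e :: real
  proof (cases "t = c")
    case True
    then show ?thesis using that by (auto intro!: always_eventually)
  next
    case False
    then have "\<forall>\<^sub>F s in nhds t. s \<noteq> c"
      by (simp add: t1_space_nhds)
    then show ?thesis by (rule eventually_mono) (use that False in auto)
  qed
  moreover have "{t. (if t = c then 1 else 0 :: real) > 0} = {c}"
    by auto
  moreover have "l * c + (1 - l) * c = c" for l :: real
    by (simp add: algebra_simps)
  ultimately show ?thesis
    unfolding is_fuzzy_number_def upper_semicontinuous_def by auto
qed

typedef fuzzy_number = "{u. is_fuzzy_number u}"
  morphisms membership Fuzzy
  using is_fuzzy_number_singleton by blast

definition level :: "fuzzy_number \<Rightarrow> real \<Rightarrow> real set" where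
  "level u \<alpha> = (if \<alpha> = 0 then closure {t. membership u t > 0} else {t. membership u t \<ge> \<alpha>})"

definition lower :: "fuzzy_number \<Rightarrow> real \<Rightarrow> real" where
  "lower u \<alpha> = Inf (level u \<alpha>)"

definition upper :: "fuzzy_number \<Rightarrow> real \<Rightarrow> real" where
  "upper u \<alpha> = Sup (level u \<alpha>)"

lemma membership_props:
  "membership u t \<ge> 0" "membership u t \<le> 1" "\<exists>t. membership u t = 1"
  "\<lbrakk>0 \<le> l; l \<le> 1\<rbrakk> \<Longrightarrow> membership u (l * s + (1 - l) * t) \<ge> min (membership u s) (membership u t)"
  "e > 0 \<Longrightarrow> \<forall>\<^sub>F s in nhds t. membership u s < membership u t + e"
  "compact (closure {t. membership u t > 0})"
  using membership[of u] unfolding is_fuzzy_number_def upper_semicontinuous_def by auto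

lemma level_nonempty: "\<alpha> \<le> 1 \<Longrightarrow> level u \<alpha> \<noteq> {}"
proof -
  assume a: "\<alpha> \<le> 1"
  obtain t where t: "membership u t = 1" using membership_props(3) by blast
  have "t \<in> closure {t. membership u t > 0}"
    using closure_subset[of "{t. membership u t > 0}"] t by auto
  moreover have "t \<in> {t. membership u t \<ge> \<alpha>}" using a t by simp
  ultimately show ?thesis unfolding level_def by (auto simp only: if_split)
qed

lemma level_antimono: "\<lbrakk>0 \<le> \<alpha>; \<alpha> \<le> \<beta>\<rbrakk> \<Longrightarrow> level u \<beta> \<subseteq> level u \<alpha>"
  using closure_subset[of "{t. membership u t > 0}"] unfolding level_def by auto

lemma convex_level: "0 \<le> \<alpha> \<Longrightarrow> convex (level u \<alpha>)"
proof -
  assume "0 \<le> \<alpha>"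
  have m: "min (membership u x) (membership u y) \<le> membership u (a * x + b * y)"
    if "0 \<le> a" "0 \<le> b" "a + b = 1" for x y a b
  proof -
    have b: "b = 1 - a" using that by simp
    show ?thesis unfolding b using that by (intro membership_props(4)) auto
  qed
  have "convex {t. membership u t > 0}"
    unfolding convex_def using m by (smt (verit) mem_Collect_eq real_scaleR_def)
  moreover have "convex {t. membership u t \<ge> \<alpha>}"
    unfolding convex_def using m by (smt (verit) mem_Collect_eq real_scaleR_def)
  ultimately show ?thesis unfolding level_def by (auto intro: convex_closure)
qed

lemma closed_level: "closed (level u \<alpha>)"
proof -
  have "open {t. \<not> membership u t \<ge> \<alpha>}"
    unfolding open_dist
  proof clarify
    fix t assume "\<not> \<alpha> \<le> membership u t"
    then have "\<forall>\<^sub>F s in nhds t. membership u s < membership u t + (\<alpha> - membership u t)"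
      by (intro membership_props(5)) simp
    then show "\<exists>e>0. \<forall>y. dist y t < e \<longrightarrow> y \<in> {t. \<not> \<alpha> \<le> membership u t}"
      unfolding eventually_nhds_metric by (auto simp: not_le)
  qed
  then have "closed {t. membership u t \<ge> \<alpha>}"
    by (simp add: closed_def Collect_neg_eq)
  then show ?thesis unfolding level_def by auto
qed

lemma compact_level: "0 \<le> \<alpha> \<Longrightarrow> compact (level u \<alpha>)"
proof -
  assume "0 \<le> \<alpha>"
  then have "level u \<alpha> \<subseteq> level u 0" using level_antimono by auto
  moreover have "compact (level u 0)" unfolding level_def using membership_props(6) by auto
  ultimately show ?thesis
    using closed_level compact_eq_bounded_closed bounded_subset by metis
qed

lemma lower_upper:
  assumes "0 \<le> \<alpha>" "\<alpha> \<le> 1"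
  shows level_eq: "level u \<alpha> = {lower u \<alpha>..upper u \<alpha>}"
    and lower_le_upper: "lower u \<alpha> \<le> upper u \<alpha>"
proof -
  have "connected (level u \<alpha>)" using convex_level convex_connected assms by blast
  then obtain a b where ab: "level u \<alpha> = {a..b}"
    using connected_compact_interval_1[of "level u \<alpha>"] compact_level[of \<alpha> u] assms
    by (auto simp: box_real)
  moreover have "a \<le> b" using level_nonempty[of \<alpha> u] ab assms by auto
  ultimately show "level u \<alpha> = {lower u \<alpha>..upper u \<alpha>}" "lower u \<alpha> \<le> upper u \<alpha>"
    unfolding lower_def upper_def by auto
qed

lemma lower_upper_unique:
  assumes "level u \<alpha> = {a..b}" "a \<le> b"
  shows "lower u \<alpha> = a" "upper u \<alpha> = b"
  using assms unfolding lower_def upper_def by auto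

lemma lower_mono: "\<lbrakk>0 \<le> \<alpha>; \<alpha> \<le> \<beta>; \<beta> \<le> 1\<rbrakk> \<Longrightarrow> lower u \<alpha> \<le> lower u \<beta>"
  and upper_antimono: "\<lbrakk>0 \<le> \<alpha>; \<alpha> \<le> \<beta>; \<beta> \<le> 1\<rbrakk> \<Longrightarrow> upper u \<beta> \<le> upper u \<alpha>"
  using level_antimono[of \<alpha> \<beta> u] level_eq[of \<alpha> u] level_eq[of \<beta> u] lower_le_upper[of \<beta> u]
  by auto

lemma fuzzy_number_eqI:
  assumes "\<And>\<alpha>. \<lbrakk>0 < \<alpha>; \<alpha> \<le> 1\<rbrakk> \<Longrightarrow> level u \<alpha> = level v \<alpha>"
  shows "u = v"
proof -
  have *: "membership u t \<le> membership v t"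
    if "\<And>\<alpha>. \<lbrakk>0 < \<alpha>; \<alpha> \<le> 1\<rbrakk> \<Longrightarrow> level u \<alpha> = level v \<alpha>" for t u v
  proof (cases "membership u t = 0")
    case True
    then show ?thesis using membership_props(1) by simp
  next
    case False
    then have "t \<in> level u (membership u t)" "0 < membership u t" "membership u t \<le> 1"
      using membership_props(1,2)[of u t] unfolding level_def by auto
    then show ?thesis using that unfolding level_def by auto
  qed
  have "membership u = membership v"
    using *[of u v] *[of v u] assms by (intro ext antisym) auto
  then show ?thesis by (simp add: membership_inject)
qed

lemma fuzzy_number_eqI':
  assumes "\<And>\<alpha>. \<lbrakk>0 \<le> \<alpha>; \<alpha> \<le> 1\<rbrakk> \<Longrightarrow> lower u \<alpha> = lower v \<alpha>"
    and "\<And>\<alpha>. \<lbrakk>0 \<le> \<alpha>; \<alpha> \<le> 1\<rbrakk> \<Longrightarrow> upper u \<alpha> = upper v \<alpha>"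
  shows "u = v"
  by (rule fuzzy_number_eqI) (simp add: level_eq assms)

lemma lower_left:
  assumes "0 < \<alpha>" "\<alpha> \<le> 1" "e > 0"
  shows "\<exists>\<beta>. 0 < \<beta> \<and> \<beta> < \<alpha> \<and> lower u \<alpha> - e < lower u \<beta> \<and> upper u \<beta> < upper u \<alpha> + e"
proof -
  have *: "\<exists>\<beta>. 0 < \<beta> \<and> \<beta> < \<alpha> \<and> x \<notin> level u \<beta>" if "x \<notin> level u \<alpha>" for x
  proof -
    have "membership u x < \<alpha>" using that assms unfolding level_def by auto
    then obtain \<beta> where "max 0 (membership u x) < \<beta>" "\<beta> < \<alpha>"
      using dense[of "max 0 (membership u x)" \<alpha>] assms by auto
    then show ?thesis by (intro exI[of _ \<beta>]) (auto simp: level_def)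
  qed
  obtain \<beta> where b: "0 < \<beta>" "\<beta> < \<alpha>" "lower u \<alpha> - e \<notin> level u \<beta>"
    using *[of "lower u \<alpha> - e"] assms by (auto simp: level_eq)
  obtain \<gamma> where c: "0 < \<gamma>" "\<gamma> < \<alpha>" "upper u \<alpha> + e \<notin> level u \<gamma>"
    using *[of "upper u \<alpha> + e"] assms by (auto simp: level_eq)
  have "lower u \<alpha> - e < lower u \<beta>"
    using b assms level_eq[of \<beta> u] lower_le_upper[of \<alpha> u] upper_antimono[of \<beta> \<alpha> u] by auto
  moreover have "upper u \<gamma> < upper u \<alpha> + e"
    using c assms level_eq[of \<gamma> u] lower_le_upper[of \<alpha> u] lower_mono[of \<gamma> \<alpha> u] by auto
  moreover have "lower u \<beta> \<le> lower u (max \<beta> \<gamma>)" "upper u (max \<beta> \<gamma>) \<le> upper u \<gamma>"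
    using b c assms by (auto intro!: lower_mono upper_antimono)
  ultimately show ?thesis
    using b c by (intro exI[of _ "max \<beta> \<gamma>"]) auto
qed

lemma lower_right_0:
  assumes "e > 0"
  shows "\<exists>\<beta>. 0 < \<beta> \<and> \<beta> \<le> 1 \<and> lower u \<beta> < lower u 0 + e \<and> upper u 0 - e < upper u \<beta>"
proof -
  have *: "\<exists>\<beta>. 0 < \<beta> \<and> \<beta> \<le> 1 \<and> (\<exists>y \<in> level u \<beta>. dist y x < e)" if x: "x \<in> level u 0" for x
  proof -
    obtain y where y: "membership u y > 0" "dist y x < e"
      using x assms unfolding level_def by (auto simp: closure_approachable)
    then show ?thesis
      by (intro exI[of _ "membership u y"]) (auto simp: level_def membership_props intro!: exI[of _ y])
  qed
  obtain \<beta> y where b: "0 < \<beta>" "\<beta> \<le> 1" "y \<in> level u \<beta>" "dist y (lower u 0) < e"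
    using *[of "lower u 0"] by (auto simp: level_eq lower_le_upper)
  obtain \<gamma> z where c: "0 < \<gamma>" "\<gamma> \<le> 1" "z \<in> level u \<gamma>" "dist z (upper u 0) < e"
    using *[of "upper u 0"] by (auto simp: level_eq lower_le_upper)
  have "lower u \<beta> < lower u 0 + e" "upper u 0 - e < upper u \<gamma>"
    using b c level_eq[of \<beta> u] level_eq[of \<gamma> u] by (auto simp: dist_real_def)
  moreover have "lower u (min \<beta> \<gamma>) \<le> lower u \<beta>" "upper u \<gamma> \<le> upper u (min \<beta> \<gamma>)"
    using b c by (auto intro!: lower_mono upper_antimono)
  ultimately show ?thesis
    using b c by (intro exI[of _ "min \<beta> \<gamma>"]) auto
qed

lemma fuzzy_number_of_levels:
  fixes a b :: "real \<Rightarrow> real"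
  assumes ab: "\<And>\<alpha>. \<lbrakk>0 \<le> \<alpha>; \<alpha> \<le> 1\<rbrakk> \<Longrightarrow> a \<alpha> \<le> b \<alpha>"
    and a: "\<And>\<alpha> \<beta>. \<lbrakk>0 \<le> \<alpha>; \<alpha> \<le> \<beta>; \<beta> \<le> 1\<rbrakk> \<Longrightarrow> a \<alpha> \<le> a \<beta>"
    and b: "\<And>\<alpha> \<beta>. \<lbrakk>0 \<le> \<alpha>; \<alpha> \<le> \<beta>; \<beta> \<le> 1\<rbrakk> \<Longrightarrow> b \<beta> \<le> b \<alpha>"
    and left: "\<And>\<alpha> e. \<lbrakk>0 < \<alpha>; \<alpha> \<le> 1; e > 0\<rbrakk> \<Longrightarrow>
      \<exists>\<beta>. 0 < \<beta> \<and> \<beta> < \<alpha> \<and> a \<alpha> - e < a \<beta> \<and> b \<beta> < b \<alpha> + e"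
    and right: "\<And>e. e > 0 \<Longrightarrow> \<exists>\<beta>. 0 < \<beta> \<and> \<beta> \<le> 1 \<and> a \<beta> < a 0 + e \<and> b 0 - e < b \<beta>"
  shows "\<exists>u. \<forall>\<alpha>\<in>{0..1}. level u \<alpha> = {a \<alpha>..b \<alpha>}"
proof -
  define S where "S t = insert 0 {\<alpha>. 0 < \<alpha> \<and> \<alpha> \<le> 1 \<and> a \<alpha> \<le> t \<and> t \<le> b \<alpha>}" for t
  define w where "w t = Sup (S t)" for t
  have S: "S t \<noteq> {}" "bdd_above (S t)" "0 \<in> S t" for t
    unfolding S_def by (auto intro!: bdd_aboveI[of _ 1])
  have w0: "0 \<le> w t" and w1: "w t \<le> 1" for t
    unfolding w_def using S by (auto intro!: cSup_upper cSup_least) (auto simp: S_def)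
  have key: "\<alpha> \<le> w t \<longleftrightarrow> a \<alpha> \<le> t \<and> t \<le> b \<alpha>" if \<alpha>: "0 < \<alpha>" "\<alpha> \<le> 1" for \<alpha> t
  proof
    assume "a \<alpha> \<le> t \<and> t \<le> b \<alpha>"
    then have "\<alpha> \<in> S t" using that unfolding S_def by auto
    then show "\<alpha> \<le> w t" unfolding w_def using S by (intro cSup_upper)
  next
    assume w: "\<alpha> \<le> w t"
    have *: "a \<beta> \<le> t \<and> t \<le> b \<beta>" if \<beta>: "0 < \<beta>" "\<beta> < \<alpha>" for \<beta>
    proof -
      have "\<beta> < Sup (S t)" using \<beta> w unfolding w_def by auto
      then obtain \<gamma> where "\<gamma> \<in> S t" "\<beta> < \<gamma>"
        using less_cSup_iff[OF S(1,2), of \<beta> t] by auto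
      then show ?thesis
        using \<beta> a[of \<beta> \<gamma>] b[of \<beta> \<gamma>] unfolding S_def by auto
    qed
    show "a \<alpha> \<le> t \<and> t \<le> b \<alpha>"
    proof (rule ccontr)
      assume "\<not> ?thesis"
      then have e: "max (a \<alpha> - t) (t - b \<alpha>) > 0" by auto
      obtain \<beta> where \<beta>: "0 < \<beta>" "\<beta> < \<alpha>" "a \<alpha> - max (a \<alpha> - t) (t - b \<alpha>) < a \<beta>"
        "b \<beta> < b \<alpha> + max (a \<alpha> - t) (t - b \<alpha>)"
        using left[OF \<alpha> e] by auto
      have "a \<beta> \<le> t" "t \<le> b \<beta>" using *[of \<beta>] \<beta> by auto
      then show False using \<beta> unfolding max_def by (auto split: if_splits)
    qed
  qed
  have fz: "is_fuzzy_number w"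
    unfolding is_fuzzy_number_def
  proof (intro conjI allI ballI)
    show "w t \<in> {0..1}" for t using w0 w1 by auto
    show "\<exists>t. w t = 1"
      using key[of 1 "a 1"] ab[of 1] w1[of "a 1"] by (intro exI[of _ "a 1"]) auto
    show "min (w s) (w t) \<le> w (l * s + (1 - l) * t)" if l: "l \<in> {0..1}" for s t l
    proof (cases "min (w s) (w t) > 0")
      case True
      let ?m = "min (w s) (w t)"
      have m: "?m \<le> 1" using w1[of s] by auto
      have "s \<in> {a ?m..b ?m}" "t \<in> {a ?m..b ?m}"
        using key[OF True m, of s] key[OF True m, of t] by auto
      then have "l *\<^sub>R s + (1 - l) *\<^sub>R t \<in> {a ?m..b ?m}"
        using l by (intro convexD) auto
      then show ?thesis using key[OF True m] by auto
    next
      case False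
      then show ?thesis using w0[of "l * s + (1 - l) * t"] by linarith
    qed
    show "upper_semicontinuous w"
      unfolding upper_semicontinuous_def
    proof (intro allI impI)
      fix t e :: real assume e: "e > 0"
      show "\<forall>\<^sub>F s in nhds t. w s < w t + e"
      proof (cases "w t + e \<le> 1")
        case True
        have pos: "0 < w t + e" using w0[of t] e by linarith
        have "open (- {a (w t + e)..b (w t + e)})" by (intro open_Compl) auto
        moreover have "t \<in> - {a (w t + e)..b (w t + e)}"
          using key[OF pos True, of t] e by auto
        ultimately have "\<forall>\<^sub>F s in nhds t. s \<in> - {a (w t + e)..b (w t + e)}"
          by (rule eventually_nhds_in_open)
        then show ?thesis
          by (rule eventually_mono) (use key[OF pos True] in \<open>auto simp: not_le[symmetric]\<close>)
      next
        case False
        then show ?thesis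
          by (intro always_eventually allI) (meson not_le le_less_trans w1)
      qed
    qed
    have "{t. w t > 0} \<subseteq> {a 0..b 0}"
    proof clarify
      fix t assume "w t > 0"
      then show "t \<in> {a 0..b 0}" using key[of "w t" t] w1[of t] a[of 0 "w t"] b[of 0 "w t"] by auto
    qed
    then have "bounded {t. w t > 0}"
      by (rule bounded_subset[OF bounded_closed_interval])
    then show "compact (closure {t. w t > 0})"
      by (simp add: compact_closure)
  qed
  define u where "u = Fuzzy w"
  have u: "membership u = w" unfolding u_def using fz by (simp add: Fuzzy_inverse)
  have pos: "level u \<alpha> = {a \<alpha>..b \<alpha>}" if "0 < \<alpha>" "\<alpha> \<le> 1" for \<alpha>
    using key[OF that] that(1) by (simp add: level_def u set_eq_iff)
  have zero: "level u 0 = {a 0..b 0}"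
  proof -
    have "lower u \<beta> = a \<beta>" "upper u \<beta> = b \<beta>" if "0 < \<beta>" "\<beta> \<le> 1" for \<beta>
      using lower_upper_unique[OF pos[OF that]] ab[of \<beta>] that by simp_all
    note lu = this
    have "lower u 0 = a 0"
    proof (rule antisym)
      show "lower u 0 \<le> a 0"
      proof (rule field_le_epsilon)
        fix e :: real assume "e > 0"
        then obtain \<beta> where "0 < \<beta>" "\<beta> \<le> 1" "a \<beta> < a 0 + e" using right by blast
        then show "lower u 0 \<le> a 0 + e" using lower_mono[of 0 \<beta> u] lu by auto
      qed
      show "a 0 \<le> lower u 0"
      proof (rule field_le_epsilon)
        fix e :: real assume "e > 0"
        then obtain \<beta> where "0 < \<beta>" "\<beta> \<le> 1" "lower u \<beta> < lower u 0 + e" using lower_right_0 by blast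
        then show "a 0 \<le> lower u 0 + e" using a[of 0 \<beta>] lu by auto
      qed
    qed
    moreover have "upper u 0 = b 0"
    proof (rule antisym)
      show "b 0 \<le> upper u 0"
      proof (rule field_le_epsilon)
        fix e :: real assume "e > 0"
        then obtain \<beta> where "0 < \<beta>" "\<beta> \<le> 1" "b 0 - e < b \<beta>" using right by blast
        then show "b 0 \<le> upper u 0 + e" using upper_antimono[of 0 \<beta> u] lu(2)[of \<beta>] by linarith
      qed
      show "upper u 0 \<le> b 0"
      proof (rule field_le_epsilon)
        fix e :: real assume "e > 0"
        then obtain \<beta> where "0 < \<beta>" "\<beta> \<le> 1" "upper u 0 - e < upper u \<beta>" using lower_right_0 by blast
        then show "upper u 0 \<le> b 0 + e" using b[of 0 \<beta>] lu(2)[of \<beta>] by linarith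
      qed
    qed
    ultimately show ?thesis using level_eq[of 0 u] by simp
  qed
  show ?thesis
  proof (intro exI[of _ u] ballI)
    fix \<alpha> :: real assume "\<alpha> \<in> {0..1}"
    then show "level u \<alpha> = {a \<alpha>..b \<alpha>}"
      using pos zero by (cases "\<alpha> = 0") simp_all
  qed
qed

instantiation fuzzy_number :: "{zero, plus, scaleR, dist}"
begin

definition zero_fuzzy_number :: fuzzy_number where
  "0 = Fuzzy (\<lambda>t. if t = 0 then 1 else 0)"

text \<open>Addition and scalar multiplication are given by their level sets; existence and
  uniqueness of the fuzzy number described are the facts \<open>level_plus\<close>, \<open>level_scaleR\<close>
  and \<open>fuzzy_number_eqI\<close>.\<close>

definition plus_fuzzy_number :: "fuzzy_number \<Rightarrow> fuzzy_number \<Rightarrow> fuzzy_number" where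
  "u + v = (THE w. \<forall>\<alpha>\<in>{0..1}. level w \<alpha> = {lower u \<alpha> + lower v \<alpha>..upper u \<alpha> + upper v \<alpha>})"

definition scaleR_fuzzy_number :: "real \<Rightarrow> fuzzy_number \<Rightarrow> fuzzy_number" where
  "k *\<^sub>R u = (THE w. \<forall>\<alpha>\<in>{0..1}. level w \<alpha> = (\<lambda>t. k * t) ` level u \<alpha>)"

definition dist_fuzzy_number :: "fuzzy_number \<Rightarrow> fuzzy_number \<Rightarrow> real" where
  "dist u v = (SUP \<alpha>\<in>{0..1}. max \<bar>lower u \<alpha> - lower v \<alpha>\<bar> \<bar>upper u \<alpha> - upper v \<alpha>\<bar>)"

instance ..

end

lemma the_level:
  assumes "\<exists>w. \<forall>\<alpha>\<in>{0..1}. level w \<alpha> = A \<alpha>" "0 \<le> \<alpha>" "\<alpha> \<le> 1"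
  shows "level (THE w. \<forall>\<alpha>\<in>{0..1}. level w \<alpha> = A \<alpha>) \<alpha> = A \<alpha>"
proof -
  have "\<exists>!w. \<forall>\<alpha>\<in>{0..1}. level w \<alpha> = A \<alpha>"
    using assms(1) by (auto intro!: fuzzy_number_eqI)
  from theI'[OF this] show ?thesis using assms by auto
qed

lemma level_plus:
  assumes "0 \<le> \<alpha>" "\<alpha> \<le> 1"
  shows "level (u + v) \<alpha> = {lower u \<alpha> + lower v \<alpha>..upper u \<alpha> + upper v \<alpha>}"
  unfolding plus_fuzzy_number_def
proof (rule the_level[OF fuzzy_number_of_levels assms])
  fix \<alpha> e :: real assume h: "0 < \<alpha>" "\<alpha> \<le> 1" "0 < e"
  obtain \<beta> where b: "0 < \<beta>" "\<beta> < \<alpha>" "lower u \<alpha> - e/2 < lower u \<beta>" "upper u \<beta> < upper u \<alpha> + e/2"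
    using lower_left[of \<alpha> "e/2" u] h by auto
  obtain \<gamma> where c: "0 < \<gamma>" "\<gamma> < \<alpha>" "lower v \<alpha> - e/2 < lower v \<gamma>" "upper v \<gamma> < upper v \<alpha> + e/2"
    using lower_left[of \<alpha> "e/2" v] h by auto
  have "lower u \<beta> \<le> lower u (max \<beta> \<gamma>)" "upper u (max \<beta> \<gamma>) \<le> upper u \<beta>"
    "lower v \<gamma> \<le> lower v (max \<beta> \<gamma>)" "upper v (max \<beta> \<gamma>) \<le> upper v \<gamma>"
    using b c h by (auto intro!: lower_mono upper_antimono)
  then have "lower u \<alpha> + lower v \<alpha> - e < lower u (max \<beta> \<gamma>) + lower v (max \<beta> \<gamma>)"
    "upper u (max \<beta> \<gamma>) + upper v (max \<beta> \<gamma>) < upper u \<alpha> + upper v \<alpha> + e"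
    using b c by linarith+
  then show "\<exists>\<beta>. 0 < \<beta> \<and> \<beta> < \<alpha> \<and> lower u \<alpha> + lower v \<alpha> - e < lower u \<beta> + lower v \<beta> \<and>
    upper u \<beta> + upper v \<beta> < upper u \<alpha> + upper v \<alpha> + e"
    using b c by (intro exI[of _ "max \<beta> \<gamma>"]) auto
next
  fix e :: real assume h: "0 < e"
  obtain \<beta> where b: "0 < \<beta>" "\<beta> \<le> 1" "lower u \<beta> < lower u 0 + e/2" "upper u 0 - e/2 < upper u \<beta>"
    using lower_right_0[of "e/2" u] h by auto
  obtain \<gamma> where c: "0 < \<gamma>" "\<gamma> \<le> 1" "lower v \<gamma> < lower v 0 + e/2" "upper v 0 - e/2 < upper v \<gamma>"
    using lower_right_0[of "e/2" v] h by auto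
  have "lower u (min \<beta> \<gamma>) \<le> lower u \<beta>" "upper u \<beta> \<le> upper u (min \<beta> \<gamma>)"
    "lower v (min \<beta> \<gamma>) \<le> lower v \<gamma>" "upper v \<gamma> \<le> upper v (min \<beta> \<gamma>)"
    using b c h by (auto intro!: lower_mono upper_antimono)
  then have "lower u (min \<beta> \<gamma>) + lower v (min \<beta> \<gamma>) < lower u 0 + lower v 0 + e"
    "upper u 0 + upper v 0 - e < upper u (min \<beta> \<gamma>) + upper v (min \<beta> \<gamma>)"
    using b c by linarith+
  then show "\<exists>\<beta>. 0 < \<beta> \<and> \<beta> \<le> 1 \<and> lower u \<beta> + lower v \<beta> < lower u 0 + lower v 0 + e \<and>
    upper u 0 + upper v 0 - e < upper u \<beta> + upper v \<beta>"
    using b c by (intro exI[of _ "min \<beta> \<gamma>"]) auto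
qed (simp_all add: add_mono lower_mono upper_antimono lower_le_upper)

lemma lower_plus: "\<lbrakk>0 \<le> \<alpha>; \<alpha> \<le> 1\<rbrakk> \<Longrightarrow> lower (u + v) \<alpha> = lower u \<alpha> + lower v \<alpha>"
  and upper_plus: "\<lbrakk>0 \<le> \<alpha>; \<alpha> \<le> 1\<rbrakk> \<Longrightarrow> upper (u + v) \<alpha> = upper u \<alpha> + upper v \<alpha>"
  using lower_upper_unique[OF level_plus] by (simp_all add: add_mono lower_le_upper)

lemma level_zero: "\<lbrakk>0 \<le> \<alpha>; \<alpha> \<le> 1\<rbrakk> \<Longrightarrow> level (0 :: fuzzy_number) \<alpha> = {0}"
  unfolding level_def zero_fuzzy_number_def
  by (auto simp: Fuzzy_inverse is_fuzzy_number_singleton)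

lemma lower_zero: "\<lbrakk>0 \<le> \<alpha>; \<alpha> \<le> 1\<rbrakk> \<Longrightarrow> lower 0 \<alpha> = 0"
  and upper_zero: "\<lbrakk>0 \<le> \<alpha>; \<alpha> \<le> 1\<rbrakk> \<Longrightarrow> upper 0 \<alpha> = 0"
  unfolding lower_def upper_def by (auto simp: level_zero)

lemma level_scaleR:
  assumes "0 \<le> \<alpha>" "\<alpha> \<le> 1"
  shows "level (k *\<^sub>R u) \<alpha> = (\<lambda>t. k * t) ` level u \<alpha>"
  unfolding scaleR_fuzzy_number_def
proof (rule the_level[OF _ assms])
  consider "k = 0" | "k > 0" | "k < 0" by linarith
  then show "\<exists>w. \<forall>\<alpha>\<in>{0..1}. level w \<alpha> = (\<lambda>t. k * t) ` level u \<alpha>"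
  proof cases
    case 1
    have "(\<lambda>t. k * t) ` level u \<alpha> = {0}" if "\<alpha> \<le> 1" for \<alpha>
      using level_nonempty[OF that, of u] 1 by auto
    then show ?thesis by (intro exI[of _ 0]) (auto simp: level_zero)
  next
    case 2
    have "\<exists>w. \<forall>\<alpha>\<in>{0..1}. level w \<alpha> = {k * lower u \<alpha>..k * upper u \<alpha>}"
    proof (rule fuzzy_number_of_levels)
      fix \<alpha> e :: real assume h: "0 < \<alpha>" "\<alpha> \<le> 1" "0 < e"
      show "\<exists>\<beta>. 0 < \<beta> \<and> \<beta> < \<alpha> \<and> k * lower u \<alpha> - e < k * lower u \<beta> \<and>
        k * upper u \<beta> < k * upper u \<alpha> + e"
        using lower_left[of \<alpha> "e/k" u] h 2 by (simp add: field_simps)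
    next
      fix e :: real assume h: "0 < e"
      show "\<exists>\<beta>. 0 < \<beta> \<and> \<beta> \<le> 1 \<and> k * lower u \<beta> < k * lower u 0 + e \<and>
        k * upper u 0 - e < k * upper u \<beta>"
        using lower_right_0[of "e/k" u] h 2 by (simp add: field_simps)
    qed (use 2 in \<open>simp_all add: lower_mono upper_antimono lower_le_upper\<close>)
    moreover have "(\<lambda>t. k * t) ` level u \<alpha> = {k * lower u \<alpha>..k * upper u \<alpha>}" if "\<alpha> \<in> {0..1}" for \<alpha>
      using that 2 lower_le_upper[of \<alpha> u] by (simp add: level_eq image_mult_atLeastAtMost)
    ultimately show ?thesis by auto
  next
    case 3
    have "\<exists>w. \<forall>\<alpha>\<in>{0..1}. level w \<alpha> = {k * upper u \<alpha>..k * lower u \<alpha>}"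
    proof (rule fuzzy_number_of_levels)
      fix \<alpha> e :: real assume h: "0 < \<alpha>" "\<alpha> \<le> 1" "0 < e"
      show "\<exists>\<beta>. 0 < \<beta> \<and> \<beta> < \<alpha> \<and> k * upper u \<alpha> - e < k * upper u \<beta> \<and>
        k * lower u \<beta> < k * lower u \<alpha> + e"
        using lower_left[of \<alpha> "e/(-k)" u] h 3 by (simp add: field_simps) blast
    next
      fix e :: real assume h: "0 < e"
      show "\<exists>\<beta>. 0 < \<beta> \<and> \<beta> \<le> 1 \<and> k * upper u \<beta> < k * upper u 0 + e \<and>
        k * lower u 0 - e < k * lower u \<beta>"
        using lower_right_0[of "e/(-k)" u] h 3 by (simp add: field_simps) blast
    qed (use 3 in \<open>simp_all add: lower_mono upper_antimono lower_le_upper\<close>)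
    moreover have "(\<lambda>t. k * t) ` level u \<alpha> = {k * upper u \<alpha>..k * lower u \<alpha>}" if "\<alpha> \<in> {0..1}" for \<alpha>
      using that 3 lower_le_upper[of \<alpha> u] image_mult_atLeastAtMost_if'[of k "lower u \<alpha>" "upper u \<alpha>"]
      by (simp add: level_eq image_mult_atLeastAtMost_if mult.commute)
    ultimately show ?thesis by auto
  qed
qed

instance fuzzy_number :: comm_monoid_add
  by standard
    (auto intro!: fuzzy_number_eqI' simp: lower_plus upper_plus lower_zero upper_zero)

instantiation fuzzy_number :: metric_space
begin

definition uniformity_fuzzy_number :: "(fuzzy_number \<times> fuzzy_number) filter" where
  "uniformity_fuzzy_number = (INF e\<in>{0 <..}. principal {(u, v). dist u v < e})"

definition open_fuzzy_number :: "fuzzy_number set \<Rightarrow> bool" where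
  "open_fuzzy_number U \<longleftrightarrow> (\<forall>u\<in>U. eventually (\<lambda>(u', v). u' = u \<longrightarrow> v \<in> U) uniformity)"

instance
proof
  fix u v w :: fuzzy_number
  let ?d = "\<lambda>u v \<alpha>. max \<bar>lower u \<alpha> - lower v \<alpha>\<bar> \<bar>upper u \<alpha> - upper v \<alpha>\<bar>"
  have bdd: "bdd_above (?d u v ` {0..1})" for u v
  proof (rule bdd_aboveI2)
    fix \<alpha> :: real assume "\<alpha> \<in> {0..1}"
    then show "?d u v \<alpha> \<le> \<bar>lower u 0\<bar> + \<bar>upper u 0\<bar> + \<bar>lower v 0\<bar> + \<bar>upper v 0\<bar>"
      using lower_mono[of 0 \<alpha> u] upper_antimono[of 0 \<alpha> u] lower_le_upper[of \<alpha> u]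
        lower_mono[of 0 \<alpha> v] upper_antimono[of 0 \<alpha> v] lower_le_upper[of \<alpha> v]
      by auto
  qed
  have le: "?d u v \<alpha> \<le> dist u v" if "0 \<le> \<alpha>" "\<alpha> \<le> 1" for u v \<alpha>
    unfolding dist_fuzzy_number_def using that by (intro cSUP_upper bdd) auto
  show "dist u v \<le> dist u w + dist v w"
    unfolding dist_fuzzy_number_def[of u v]
  proof (rule cSUP_least)
    fix \<alpha> :: real assume "\<alpha> \<in> {0..1}"
    then show "?d u v \<alpha> \<le> dist u w + dist v w"
      using le[of \<alpha> u w] le[of \<alpha> v w] by auto
  qed auto
  show "(dist u v = 0) = (u = v)"
  proof
    assume "dist u v = 0"
    then show "u = v"
      using le[of _ u v] by (intro fuzzy_number_eqI') force+
  qed (simp add: dist_fuzzy_number_def)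
qed (simp_all add: uniformity_fuzzy_number_def open_fuzzy_number_def)

end

definition euler_mean :: "real \<Rightarrow> (nat \<Rightarrow> fuzzy_number) \<Rightarrow> nat \<Rightarrow> fuzzy_number" where
  "euler_mean p u n = (1 / (p + 1) ^ n) *\<^sub>R (\<Sum>k=0..n. (real (n choose k) * p ^ (n - k)) *\<^sub>R u k)"

definition euler_summable :: "real \<Rightarrow> (nat \<Rightarrow> fuzzy_number) \<Rightarrow> fuzzy_number \<Rightarrow> bool" where
  "euler_summable p u \<mu> \<longleftrightarrow> euler_mean p u \<longlonglongrightarrow> \<mu>"

end

theory Submission
  imports Defs
begin

text \<open>
  The \<open>n\<close>-th Euler mean of order \<open>p\<close> is \<open>((S + p) / (1 + p))\<^sup>n\<close>, with \<open>S\<close> the shift, applied to the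
  sequence and read off at index 0. Hence Euler means compose: a mean of order \<open>q\<close> of means of order
  \<open>p\<close> is a mean of the order \<open>r\<close> with \<open>1 + r = (1 + q) (1 + p)\<close>. Given \<open>s > p > 0\<close>, this presents the
  \<open>E\<^sub>s\<close> means as \<open>E\<^sub>q\<close> means of the \<open>E\<^sub>p\<close> means for a positive \<open>q\<close>, and it remains to see that \<open>E\<^sub>q\<close>
  preserves limits (\<open>euler_mean_regular\<close>).

  Fuzzy numbers are not a vector space, as \<open>u + (-1) u\<close> need not be 0. With nonnegative
  coefficients, however, the end points of every level set are linear in the fuzzy number, so for
  nonnegative orders the composition law follows from that of real Euler means, applied to the end
  points. The Euler means of a constant real sequence are constant; so the distance from
  \<open>euler_mean q v n\<close> to \<open>\<mu>\<close> is at most the real Euler mean of the distances from \<open>v k\<close> to \<open>\<mu>\<close>, and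
  regularity is reduced to real null sequences. There it is the Toeplitz argument: the weights are
  nonnegative with sum 1, and for each \<open>k\<close> the weight of the \<open>k\<close>-th term tends to 0.
\<close>

section \<open>Binomial sums and Euler means of real sequences\<close>

text \<open>The value at index 0 of \<open>(S + p)\<^sup>n a\<close>, where \<open>S\<close> is the shift, expanded by the binomial
  theorem. Keeping it apart from its normalisation \<open>(p + 1)\<^sup>n\<close> makes the composition law additive
  in \<open>p\<close>.\<close>

definition binomial_sum :: "real \<Rightarrow> (nat \<Rightarrow> real) \<Rightarrow> nat \<Rightarrow> real" where
  "binomial_sum p a n = (\<Sum>k=0..n. real (n choose k) * p ^ (n - k) * a k)"

definition real_euler_mean :: "real \<Rightarrow> (nat \<Rightarrow> real) \<Rightarrow> nat \<Rightarrow> real" where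
  "real_euler_mean p a n = binomial_sum p a n / (p + 1) ^ n"

lemma binomial_sum_0 [simp]: "binomial_sum p a 0 = a 0"
  by (simp add: binomial_sum_def)

lemma binomial_sum_add:
  "binomial_sum p (\<lambda>k. a k + b k) n = binomial_sum p a n + binomial_sum p b n"
  by (simp add: binomial_sum_def distrib_left sum.distrib)

lemma binomial_sum_diff:
  "binomial_sum p (\<lambda>k. a k - b k) n = binomial_sum p a n - binomial_sum p b n"
  by (simp add: binomial_sum_def right_diff_distrib sum_subtractf)

lemma binomial_sum_cmult: "binomial_sum p (\<lambda>k. c * a k) n = c * binomial_sum p a n"
  by (simp add: binomial_sum_def sum_distrib_left mult_ac)

lemma binomial_sum_const: "binomial_sum p (\<lambda>k. c) n = c * (p + 1) ^ n"
proof -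
  have "(\<Sum>k=0..n. real (n choose k) * p ^ (n - k)) = (1 + p) ^ n"
    by (simp add: binomial_ring atLeast0AtMost)
  then show ?thesis
    by (simp add: binomial_sum_def sum_distrib_right[symmetric] add.commute)
qed

text \<open>Pascal's rule: one more application of the operator "shift plus \<open>p\<close>".\<close>

lemma binomial_sum_Suc:
  "binomial_sum p a (Suc n) = p * binomial_sum p a n + binomial_sum p (\<lambda>k. a (Suc k)) n"
proof -
  have "binomial_sum p a (Suc n) = p ^ Suc n * a 0
      + (\<Sum>k=0..n. real (Suc n choose Suc k) * p ^ (n - k) * a (Suc k))"
    unfolding binomial_sum_def by (subst sum.atLeast0_atMost_Suc_shift) simp
  also have "\<dots> = p ^ Suc n * a 0 + (\<Sum>k=0..n. real (n choose Suc k) * p ^ (n - k) * a (Suc k))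
      + binomial_sum p (\<lambda>k. a (Suc k)) n"
    by (simp add: binomial_sum_def distrib_right sum.distrib)
  also have "p ^ Suc n * a 0 + (\<Sum>k=0..n. real (n choose Suc k) * p ^ (n - k) * a (Suc k))
      = (\<Sum>k=0..Suc n. real (n choose k) * p ^ (Suc n - k) * a k)"
    by (subst sum.atLeast0_atMost_Suc_shift) simp
  also have "\<dots> = p * binomial_sum p a n"
    unfolding binomial_sum_def sum_distrib_left
    by (simp add: Suc_diff_le mult_ac)
  finally show ?thesis .
qed

text \<open>Replacing \<open>n\<close> by \<open>n + 1\<close> in \<open>(S + p)\<^sup>n a\<close> applies \<open>S + p\<close> once more, so on the sequence of
  these values the shift acts as \<open>S + p\<close>, and the outer \<open>S + q\<close> acts as \<open>S + p + q\<close>.\<close>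

lemma binomial_sum_binomial_sum:
  "binomial_sum q (binomial_sum p a) n = binomial_sum (p + q) a n"
proof (induction n arbitrary: a)
  case (Suc n)
  have "binomial_sum q (binomial_sum p a) (Suc n) = q * binomial_sum q (binomial_sum p a) n
      + binomial_sum q (\<lambda>k. p * binomial_sum p a k + binomial_sum p (\<lambda>j. a (Suc j)) k) n"
    by (simp only: binomial_sum_Suc)
  also have "\<dots> = q * binomial_sum (p + q) a n
      + (p * binomial_sum (p + q) a n + binomial_sum (p + q) (\<lambda>j. a (Suc j)) n)"
    by (simp only: binomial_sum_add binomial_sum_cmult Suc.IH)
  also have "\<dots> = binomial_sum (p + q) a (Suc n)"
    by (simp only: binomial_sum_Suc distrib_right)
  finally show ?case .
qed simp

text \<open>The inner normalisation can be pulled out of an outer binomial sum at the price of rescaling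
  the outer order.\<close>

lemma binomial_sum_divide_power:
  assumes "c \<noteq> 0"
  shows "binomial_sum q (\<lambda>k. a k / c ^ k) n = binomial_sum (q * c) a n / c ^ n"
  unfolding binomial_sum_def sum_divide_distrib
proof (rule sum.cong[OF refl])
  fix k assume "k \<in> {0..n}"
  then have "c ^ n = c ^ k * c ^ (n - k)"
    by (simp add: power_add[symmetric])
  then show "real (n choose k) * q ^ (n - k) * (a k / c ^ k)
      = real (n choose k) * (q * c) ^ (n - k) * a k / c ^ n"
    using assms by (simp add: power_mult_distrib)
qed

lemma real_euler_mean_compose:
  assumes "p + 1 \<noteq> 0" "(q + 1) * (p + 1) = r + 1"
  shows "real_euler_mean q (real_euler_mean p a) n = real_euler_mean r a n"
proof -
  have r: "p + q * (p + 1) = r"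
    using assms(2) by (simp add: algebra_simps)
  show ?thesis
    unfolding real_euler_mean_def binomial_sum_divide_power[OF assms(1)]
      binomial_sum_binomial_sum r
    by (simp add: assms(2)[symmetric] power_mult_distrib)
qed

lemma abs_real_euler_mean_diff_le:
  assumes "p \<ge> 0" "\<And>k. \<bar>a k - c\<bar> \<le> d k"
  shows "\<bar>real_euler_mean p a n - c\<bar> \<le> real_euler_mean p d n"
proof -
  have "real_euler_mean p a n - c = binomial_sum p (\<lambda>k. a k - c) n / (p + 1) ^ n"
    using assms(1) by (simp add: real_euler_mean_def binomial_sum_diff binomial_sum_const field_simps)
  moreover have "\<bar>binomial_sum p (\<lambda>k. a k - c) n\<bar> \<le> binomial_sum p d n"
    unfolding binomial_sum_def
    by (rule sum_abs[THEN order_trans], rule sum_mono) (use assms in \<open>simp add: abs_mult mult_left_mono\<close>)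
  ultimately show ?thesis
    using assms(1) by (simp add: real_euler_mean_def divide_right_mono)
qed

text \<open>Written as \<open>(n y\<^sup>n)\<^sup>k y\<^sup>n\<close> with \<open>x = y\<^sup>k\<^sup>+\<^sup>1\<close>, the expression is a product of null
  sequences.\<close>

lemma power_times_geometric_tendsto_0:
  fixes x :: real
  assumes "0 < x" "x < 1"
  shows "(\<lambda>n. real n ^ k * x ^ n) \<longlonglongrightarrow> 0"
proof -
  define y where "y = root (Suc k) x"
  have y: "0 < y" "y < 1" "y ^ Suc k = x"
    unfolding y_def using assms by (simp_all add: real_root_lt_1_iff del: power_Suc)
  have "(\<lambda>n. (real n * y ^ n) ^ k * y ^ n) \<longlonglongrightarrow> 0 ^ k * 0"
    using y by (intro tendsto_mult tendsto_power powser_times_n_limit_0 LIMSEQ_power_zero) auto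
  moreover have "real n ^ k * x ^ n = (real n * y ^ n) ^ k * y ^ n" for n
    by (simp add: y(3)[symmetric] power_mult_distrib power_mult[symmetric] mult.commute)
  ultimately show ?thesis
    by simp
qed

text \<open>As \<open>k\<close> is fixed and \<open>n choose k \<le> n\<^sup>k\<close>, the geometric factor \<open>(q / (q + 1))\<^sup>n\<close> wins.\<close>

lemma euler_weight_tendsto_0:
  assumes "q > 0"
  shows "(\<lambda>n. real (n choose k) * q ^ (n - k) / (q + 1) ^ n) \<longlonglongrightarrow> 0"
proof (rule tendsto_sandwich[OF _ _ tendsto_const])
  define x where "x = q / (q + 1)"
  have "0 < x" "x < 1"
    using assms by (auto simp: x_def)
  then show "(\<lambda>n. real n ^ k * x ^ n / q ^ k) \<longlonglongrightarrow> 0"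
    using tendsto_divide[OF power_times_geometric_tendsto_0 tendsto_const, of x "q ^ k" k] assms
    by simp
  show "\<forall>\<^sub>F n in sequentially. real (n choose k) * q ^ (n - k) / (q + 1) ^ n
      \<le> real n ^ k * x ^ n / q ^ k"
  proof (rule eventually_sequentiallyI)
    fix n assume n: "k \<le> n"
    have "real (n choose k) \<le> real n ^ k"
      using binomial_le_pow[OF n] by (metis of_nat_le_iff of_nat_power)
    then have "real (n choose k) * q ^ (n - k) / (q + 1) ^ n
        \<le> real n ^ k * q ^ (n - k) / (q + 1) ^ n"
      using assms by (intro divide_right_mono mult_right_mono) auto
    also have "\<dots> = real n ^ k * x ^ n / q ^ k"
      using assms n by (simp add: x_def power_divide power_diff)
    finally show "real (n choose k) * q ^ (n - k) / (q + 1) ^ n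
        \<le> real n ^ k * x ^ n / q ^ k" .
  qed
  show "\<forall>\<^sub>F n in sequentially. 0 \<le> real (n choose k) * q ^ (n - k) / (q + 1) ^ n"
    using assms by (intro always_eventually allI) simp
qed

text \<open>The weights are nonnegative and sum to 1. Hence the terms from index \<open>N\<close> on, all small,
  contribute little to the mean, and the finitely many earlier ones lose their weight as \<open>n\<close>
  grows.\<close>

lemma real_euler_mean_tendsto_0:
  assumes "q > 0" "d \<longlonglongrightarrow> 0"
  shows "real_euler_mean q d \<longlonglongrightarrow> 0"
proof (rule LIMSEQ_I)
  define w where "w n k = real (n choose k) * q ^ (n - k) / (q + 1) ^ n" for n k
  have mean: "real_euler_mean q f n = (\<Sum>k=0..n. w n k * f k)" for f n
    by (simp add: real_euler_mean_def binomial_sum_def w_def sum_divide_distrib)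
  have w: "w n k \<ge> 0" for n k
    using assms(1) by (simp add: w_def)
  fix e :: real assume e: "e > 0"
  obtain N where N: "\<And>k. k \<ge> N \<Longrightarrow> \<bar>d k\<bar> < e / 2"
    using LIMSEQ_D[OF assms(2), of "e / 2"] e by auto
  have "(\<lambda>n. \<Sum>k<N. w n k * \<bar>d k\<bar>) \<longlonglongrightarrow> (\<Sum>k<N. 0 * \<bar>d k\<bar>)"
    unfolding w_def by (intro tendsto_intros euler_weight_tendsto_0 assms)
  then obtain M where M: "\<And>n. n \<ge> M \<Longrightarrow> \<bar>\<Sum>k<N. w n k * \<bar>d k\<bar>\<bar> < e / 2"
    using LIMSEQ_D[of "\<lambda>n. \<Sum>k<N. w n k * \<bar>d k\<bar>" 0 "e / 2"] e by auto
  have "\<bar>real_euler_mean q d n\<bar> < e" if n: "n \<ge> max M N" for n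
  proof -
    have "\<bar>real_euler_mean q d n\<bar> \<le> (\<Sum>k=0..n. w n k * \<bar>d k\<bar>)"
      unfolding mean by (rule sum_abs[THEN order_trans]) (simp add: abs_mult w)
    also have "\<dots> = (\<Sum>k<N. w n k * \<bar>d k\<bar>) + (\<Sum>k=N..n. w n k * \<bar>d k\<bar>)"
      using n by (subst sum.union_disjoint[symmetric]) (auto intro!: sum.cong)
    also have "(\<Sum>k=N..n. w n k * \<bar>d k\<bar>) \<le> (\<Sum>k=N..n. w n k * (e / 2))"
      using N by (intro sum_mono mult_left_mono w) (simp add: less_imp_le)
    also have "\<dots> \<le> (\<Sum>k=0..n. w n k * (e / 2))"
      using e w by (intro sum_mono2) auto
    also have "\<dots> = e / 2"
      using assms(1) by (simp only: mean[symmetric]) (simp add: real_euler_mean_def binomial_sum_const)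
    finally show ?thesis
      using M[of n] n by simp
  qed
  then show "\<exists>M. \<forall>n\<ge>M. norm (real_euler_mean q d n - 0) < e"
    by (intro exI[of _ "max M N"]) simp
qed

section \<open>End points of level sets and the metric\<close>

lemma
  assumes "0 \<le> \<alpha>" "\<alpha> \<le> 1" "0 \<le> k"
  shows lower_scaleR: "lower (k *\<^sub>R u) \<alpha> = k * lower u \<alpha>"
    and upper_scaleR: "upper (k *\<^sub>R u) \<alpha> = k * upper u \<alpha>"
proof -
  have "level (k *\<^sub>R u) \<alpha> = {k * lower u \<alpha>..k * upper u \<alpha>}"
    unfolding level_scaleR[OF assms(1,2)] level_eq[OF assms(1,2), of u]
    using assms lower_le_upper[of \<alpha> u] by (simp add: image_mult_atLeastAtMost_if)
  moreover have "k * lower u \<alpha> \<le> k * upper u \<alpha>"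
    using assms lower_le_upper[of \<alpha> u] by (simp add: mult_left_mono)
  ultimately show "lower (k *\<^sub>R u) \<alpha> = k * lower u \<alpha>" "upper (k *\<^sub>R u) \<alpha> = k * upper u \<alpha>"
    by (rule lower_upper_unique)+
qed

lemma
  assumes "0 \<le> \<alpha>" "\<alpha> \<le> 1"
  shows lower_sum: "lower (sum f A) \<alpha> = (\<Sum>k\<in>A. lower (f k) \<alpha>)"
    and upper_sum: "upper (sum f A) \<alpha> = (\<Sum>k\<in>A. upper (f k) \<alpha>)"
  by (induction A rule: infinite_finite_induct)
    (simp_all add: assms lower_plus upper_plus lower_zero upper_zero)

lemma
  assumes "0 \<le> \<alpha>" "\<alpha> \<le> 1" "0 \<le> p"
  shows lower_euler_mean:
      "lower (euler_mean p u n) \<alpha> = real_euler_mean p (\<lambda>k. lower (u k) \<alpha>) n"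
    and upper_euler_mean:
      "upper (euler_mean p u n) \<alpha> = real_euler_mean p (\<lambda>k. upper (u k) \<alpha>) n"
  using assms
  by (simp_all add: euler_mean_def real_euler_mean_def binomial_sum_def lower_scaleR upper_scaleR
      lower_sum upper_sum)

lemma
  assumes "0 \<le> \<alpha>" "\<alpha> \<le> 1"
  shows abs_lower_diff_le_dist: "\<bar>lower u \<alpha> - lower v \<alpha>\<bar> \<le> dist u v"
    and abs_upper_diff_le_dist: "\<bar>upper u \<alpha> - upper v \<alpha>\<bar> \<le> dist u v"
proof -
  let ?d = "\<lambda>\<alpha>. max \<bar>lower u \<alpha> - lower v \<alpha>\<bar> \<bar>upper u \<alpha> - upper v \<alpha>\<bar>"
  have "bdd_above (?d ` {0..1})"
  proof (rule bdd_aboveI2)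
    fix \<beta> :: real assume "\<beta> \<in> {0..1}"
    then show "?d \<beta> \<le> \<bar>lower u 0\<bar> + \<bar>upper u 0\<bar> + \<bar>lower v 0\<bar> + \<bar>upper v 0\<bar>"
      using lower_mono[of 0 \<beta> u] upper_antimono[of 0 \<beta> u] lower_le_upper[of \<beta> u]
        lower_mono[of 0 \<beta> v] upper_antimono[of 0 \<beta> v] lower_le_upper[of \<beta> v]
      by auto
  qed
  then have "?d \<alpha> \<le> dist u v"
    unfolding dist_fuzzy_number_def using assms by (intro cSUP_upper) auto
  then show "\<bar>lower u \<alpha> - lower v \<alpha>\<bar> \<le> dist u v" "\<bar>upper u \<alpha> - upper v \<alpha>\<bar> \<le> dist u v"
    by auto
qed

section \<open>Euler means of fuzzy numbers\<close>

lemma euler_mean_compose: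
  assumes "p \<ge> 0" "q \<ge> 0" "(q + 1) * (p + 1) = r + 1"
  shows "euler_mean q (euler_mean p u) = euler_mean r u"
proof -
  have "r = q * p + q + p"
    using assms(3) by (simp add: algebra_simps)
  then have "r \<ge> 0"
    using assms by simp
  then show ?thesis
    using assms real_euler_mean_compose[of p q r]
    by (intro ext fuzzy_number_eqI') (simp_all add: lower_euler_mean upper_euler_mean)
qed

lemma dist_euler_mean_le:
  assumes "q \<ge> 0"
  shows "dist (euler_mean q v n) \<mu> \<le> real_euler_mean q (\<lambda>k. dist (v k) \<mu>) n"
  unfolding dist_fuzzy_number_def[of "euler_mean q v n"]
proof (rule cSUP_least)
  fix \<alpha> :: real assume "\<alpha> \<in> {0..1}"
  then show "max \<bar>lower (euler_mean q v n) \<alpha> - lower \<mu> \<alpha>\<bar> \<bar>upper (euler_mean q v n) \<alpha> - upper \<mu> \<alpha>\<bar>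
      \<le> real_euler_mean q (\<lambda>k. dist (v k) \<mu>) n"
    using assms
    by (simp add: lower_euler_mean upper_euler_mean abs_real_euler_mean_diff_le
        abs_lower_diff_le_dist abs_upper_diff_le_dist)
qed simp

lemma euler_mean_regular:
  assumes "q > 0" "v \<longlonglongrightarrow> \<mu>"
  shows "euler_mean q v \<longlonglongrightarrow> \<mu>"
proof -
  have "real_euler_mean q (\<lambda>k. dist (v k) \<mu>) \<longlonglongrightarrow> 0"
    using assms by (intro real_euler_mean_tendsto_0) (simp_all only: tendsto_dist_iff[of v])
  then have "(\<lambda>n. dist (euler_mean q v n) \<mu>) \<longlonglongrightarrow> 0"
    by (rule tendsto_sandwich[rotated 2, OF tendsto_const])
      (use assms in \<open>auto intro!: always_eventually dist_euler_mean_le\<close>)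
  then show ?thesis
    by (subst tendsto_dist_iff)
qed

theorem theorem4p2:
  fixes u :: "nat \<Rightarrow> fuzzy_number" and \<mu> :: fuzzy_number and s p :: real
  assumes "s > p" and "p > 0"
    and "euler_summable p u \<mu>"
  shows "euler_summable s u \<mu>"
proof -
  define q where "q = (s - p) / (p + 1)"
  have q: "q > 0" "(q + 1) * (p + 1) = s + 1"
    using assms(1,2) by (simp_all add: q_def field_simps)
  have "euler_mean q (euler_mean p u) \<longlonglongrightarrow> \<mu>"
    using euler_mean_regular[OF q(1)] assms(3) by (simp add: euler_summable_def)
  then show ?thesis
    using euler_mean_compose[OF _ _ q(2)] assms(2) q(1) by (simp add: euler_summable_def)
qed

end
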